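(* Let $\ell\geq 3$ and $k\geq \ell-2$ be integers. There is $n_0=n_0(k,\ell)$ such that for every $n\geq n_0$ the following holds. If $\mathcal{F}\subset\binom{[n]}{k}$ is a family such that $$\binom{\ell-1}{2}\leq \sum_{1\leq i<j\leq \ell}|F_i\cap F_j|$$ holds for every choice of $\ell$ distinct members $F_1,\dots,F_\ell$ of $\mathcal{F}$, then $$|\mathcal{F}|\leq \binom{n-1}{k-1}+\binom{n-\ell+1}{k-\ell+2}.$$
   Context: $[n]=\{1,\dots,n\}$ and $\binom{[n]}{k}$ denotes the family of all $k$-element subsets of $[n]$. *)

theory Defs
  imports Complex_Main "HOL-Library.Ramsey"
begin

end

theory Submission
  imports Defs
begin

text \<open>Call a vertex heavy if its degree in the family exceeds a suitable constant times
  \<open>n ^ (k - 2)\<close>. Without a heavy vertex, the union of a maximal matching, which has fewer than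
  \<open>l\<close> members, is a bounded cover by vertices of small degree, so the family has only
  \<open>O(n ^ (k - 2))\<close> members. A heavy vertex \<open>x\<close> is the kernel of sunflowers with \<open>l - 2\<close> petals
  that avoid any two given members \<open>G\<close>, \<open>H\<close> not containing \<open>x\<close>; such a sunflower contributes
  only \<open>(l - 2) choose 2\<close> to the sum, so \<open>G\<close> and \<open>H\<close> share at least \<open>l - 2\<close> points. The members
  avoiding \<open>x\<close> are thus an \<open>(l - 2)\<close>-intersecting family on \<open>n - 1\<close> points, and the
  Erdos-Ko-Rado theorem for large ground sets bounds their number.\<close>

section \<open>Counting\<close>

lemma card_nsets_supersets_le:
  assumes "finite V" "S \<subseteq> V"
  shows "card {F \<in> nsets V k. S \<subseteq> F} \<le> (card V - card S) choose (k - card S)"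
proof -
  have fin: "finite S" using assms finite_subset by blast
  have "card {F \<in> nsets V k. S \<subseteq> F} \<le> card (nsets (V - S) (k - card S))"
  proof (rule card_inj_on_le)
    show "inj_on (\<lambda>F. F - S) {F \<in> nsets V k. S \<subseteq> F}"
      by (auto simp: inj_on_def)
    show "(\<lambda>F. F - S) ` {F \<in> nsets V k. S \<subseteq> F} \<subseteq> nsets (V - S) (k - card S)"
      using fin by (auto simp: nsets_def card_Diff_subset)
    show "finite (nsets (V - S) (k - card S))"
      using assms by (simp add: finite_imp_finite_nsets)
  qed
  also have "\<dots> = (card V - card S) choose (k - card S)"
    using assms fin by (simp add: card_nsets card_Diff_subset)
  finally show ?thesis .
qed

text \<open>A crude form of the previous bound, sufficient wherever only the order of magnitude in
  \<open>card V\<close> matters.\<close>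

lemma card_nsets_supersets_le_power:
  assumes "finite V"
  shows "card {F \<in> nsets V k. S \<subseteq> F} \<le> card V ^ (k - card S)"
proof (cases "S \<subseteq> V")
  case True
  have "(card V - card S) choose (k - card S) \<le> (card V - card S) ^ (k - card S)"
    by (metis binomial_eq_0 binomial_le_pow linorder_not_less zero_le)
  also have "\<dots> \<le> card V ^ (k - card S)"
    by (simp add: power_mono)
  finally show ?thesis
    using card_nsets_supersets_le[OF assms True, of k] by linarith
next
  case False
  then have "{F \<in> nsets V k. S \<subseteq> F} = {}" by (auto simp: nsets_def)
  then show ?thesis by (simp only: card.empty)
qed

text \<open>For fixed \<open>c\<close>, \<open>t\<close> and \<open>m\<close> the right side grows
  in \<open>N\<close> with degree \<open>m\<close>, the left side only with degree
  \<open>m - 1\<close>.\<close>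

lemma eventually_power_le_binomial:
  assumes "m \<ge> 1"
  obtains N0 :: nat where "\<And>N. N \<ge> N0 \<Longrightarrow> c * N ^ (m - 1) \<le> (N - t) choose m"
proof
  fix N :: nat
  \<comment> \<open>The first summand lets one factor \<open>N\<close> absorb all constants,
    \<open>2 * t\<close> gives \<open>N - t \<ge> N / 2\<close>, and \<open>m\<close> keeps the
    binomial in the range \<open>m \<le> N - t\<close>.\<close>
  assume N: "N \<ge> c * (2 * m) ^ m + 2 * t + m"
  have "real c * real N ^ (m - 1) \<le> (real (N - t) / real m) ^ m"
  proof -
    have "real c * (2 * real m) ^ m \<le> real N"
      using N by (metis (mono_tags, lifting) add_leD1 of_nat_le_iff of_nat_mult of_nat_numeral of_nat_power)
    then have "real c * (2 * real m) ^ m * real N ^ (m - 1) \<le> real N * real N ^ (m - 1)"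
      by (intro mult_right_mono) auto
    also have "\<dots> = real N ^ m"
      using assms by (simp flip: power_Suc)
    finally have "real c * real N ^ (m - 1) \<le> (real N / (2 * real m)) ^ m"
      using assms by (simp add: power_divide field_simps)
    also have "\<dots> \<le> (real (N - t) / real m) ^ m"
      using N assms by (intro power_mono) (auto simp: field_simps of_nat_diff)
    finally show ?thesis .
  qed
  also have "\<dots> \<le> real ((N - t) choose m)"
  proof (cases "m \<le> N - t")
    case True
    then show ?thesis using binomial_ge_n_over_k_pow_k[of m "N - t", where 'a = real] by simp
  next
    case False
    then show ?thesis using N by simp
  qed
  finally have "real (c * N ^ (m - 1)) \<le> real ((N - t) choose m)" by simp
  then show "c * N ^ (m - 1) \<le> (N - t) choose m" by linarith
qed

section \<open>The Erdos-Ko-Rado theorem for large ground sets\<close>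

text \<open>As no \<open>t\<close>-set lies in all members, a set \<open>S\<close> of at most \<open>t\<close> points meets some member \<open>G\<close> in
  fewer than \<open>t\<close> points; every member containing \<open>S\<close> then contains some \<open>y \<in> G - S\<close>.
  Branching over \<open>y\<close> increases \<open>S\<close> up to size \<open>t + 1\<close>.\<close>

lemma nontrivial_intersecting_family_supersets_le:
  assumes V: "finite V" and B: "B \<subseteq> nsets V k"
    and int: "\<And>G H. G \<in> B \<Longrightarrow> H \<in> B \<Longrightarrow> t \<le> card (G \<inter> H)"
    and nontriv: "\<And>T. card T = t \<Longrightarrow> finite T \<Longrightarrow> \<exists>G\<in>B. \<not> T \<subseteq> G"
    and ne: "B \<noteq> {}"
  shows "finite S \<Longrightarrow> card S + j = t + 1 \<Longrightarrow>
    card {F \<in> B. S \<subseteq> F} \<le> k ^ j * card V ^ (k - (t + 1))"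
proof (induction j arbitrary: S)
  case 0
  have "card {F \<in> B. S \<subseteq> F} \<le> card {F \<in> nsets V k. S \<subseteq> F}"
    using B V by (intro card_mono) (auto simp: finite_imp_finite_nsets)
  also have "\<dots> \<le> card V ^ (k - card S)"
    by (rule card_nsets_supersets_le_power[OF V])
  finally show ?case using 0 by simp
next
  case (Suc j)
  have finB: "finite B" using B V finite_imp_finite_nsets finite_subset by blast
  obtain G where G: "G \<in> B" "card (S \<inter> G) < t"
  proof (cases "card S = t")
    case True
    then obtain G where "G \<in> B" "\<not> S \<subseteq> G" using nontriv Suc.prems by blast
    moreover from this have "card (S \<inter> G) < card S"
      using Suc.prems by (intro psubset_card_mono) auto
    ultimately show ?thesis using True that by blast
  next
    case False
    obtain G where "G \<in> B" using ne by blast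
    moreover have "card (S \<inter> G) \<le> card S" using Suc.prems by (intro card_mono) auto
    ultimately show ?thesis using False Suc.prems that by force
  qed
  have finG: "finite G" and cardG: "card G = k" using G B by (auto simp: nsets_def)
  have "{F \<in> B. S \<subseteq> F} \<subseteq> (\<Union>y \<in> G - S. {F \<in> B. insert y S \<subseteq> F})"
  proof
    fix F assume F: "F \<in> {F \<in> B. S \<subseteq> F}"
    have "\<not> F \<inter> G \<subseteq> S \<inter> G"
    proof
      assume "F \<inter> G \<subseteq> S \<inter> G"
      then have "card (F \<inter> G) \<le> card (S \<inter> G)" using Suc.prems by (intro card_mono) auto
      then show False using int[of F G] F G by auto
    qed
    then show "F \<in> (\<Union>y \<in> G - S. {F \<in> B. insert y S \<subseteq> F})" using F by auto
  qed
  then have "card {F \<in> B. S \<subseteq> F} \<le> card (\<Union>y \<in> G - S. {F \<in> B. insert y S \<subseteq> F})"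
    using finG finB by (intro card_mono) auto
  also have "\<dots> \<le> (\<Sum>y \<in> G - S. card {F \<in> B. insert y S \<subseteq> F})"
    using finG by (intro card_UN_le) auto
  also have "\<dots> \<le> (\<Sum>y \<in> G - S. k ^ j * card V ^ (k - (t + 1)))"
    using Suc.prems by (intro sum_mono Suc.IH) auto
  also have "\<dots> \<le> k * (k ^ j * card V ^ (k - (t + 1)))"
    using finG cardG by (auto intro!: mult_right_mono card_mono simp flip: cardG)
  finally show ?case by simp
qed

text \<open>If some \<open>t\<close>-set lies in all members, counting its supersets gives the
  bound. Otherwise branching from the empty set in \<open>t + 1\<close> levels leaves only
  \<open>O(N ^ (k - t - 1))\<close> members, fewer than the binomial of degree \<open>k - t\<close>
  for large \<open>N\<close>.\<close>

theorem Erdos_Ko_Rado_large: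
  fixes t k :: nat
  assumes "t \<le> k"
  obtains N0 where "\<And>(V :: 'a set) B. finite V \<Longrightarrow> card V \<ge> N0 \<Longrightarrow> B \<subseteq> nsets V k \<Longrightarrow>
    (\<And>G H. G \<in> B \<Longrightarrow> H \<in> B \<Longrightarrow> G \<noteq> H \<Longrightarrow> t \<le> card (G \<inter> H)) \<Longrightarrow>
    card B \<le> (card V - t) choose (k - t)"
proof -
  obtain N0 where N0: "k > t \<Longrightarrow> N \<ge> N0 \<Longrightarrow> k ^ (t + 1) * N ^ (k - t - 1) \<le> (N - t) choose (k - t)" for N
  proof (cases "k > t")
    case True
    then have "1 \<le> k - t" by simp
    then show ?thesis
      by (rule eventually_power_le_binomial[where c = "k ^ (t + 1)" and t = t]) (rule that)
  qed (use that in blast)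
  show thesis
  proof (rule that)
    fix V :: "'a set" and B
    assume V: "finite V" "card V \<ge> N0" and B: "B \<subseteq> nsets V k"
      and int': "\<And>G H. G \<in> B \<Longrightarrow> H \<in> B \<Longrightarrow> G \<noteq> H \<Longrightarrow> t \<le> card (G \<inter> H)"
    have int: "t \<le> card (G \<inter> H)" if "G \<in> B" "H \<in> B" for G H
      using int'[of G H] that B assms by (cases "G = H") (auto simp: nsets_def)
    show "card B \<le> (card V - t) choose (k - t)"
    proof (cases "B = {} \<or> (\<exists>T. finite T \<and> card T = t \<and> (\<forall>G\<in>B. T \<subseteq> G))")
      case True
      show ?thesis
      proof (cases "B = {}")
        case False
        with True obtain T where T: "finite T" "card T = t" "\<forall>G\<in>B. T \<subseteq> G" by blast
        have "T \<subseteq> V" using False T B by (fastforce simp: nsets_def)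
        have "card B \<le> card {F \<in> nsets V k. T \<subseteq> F}"
          using B V T by (intro card_mono) (auto simp: finite_imp_finite_nsets)
        also have "\<dots> \<le> (card V - t) choose (k - t)"
          using card_nsets_supersets_le[OF V(1) \<open>T \<subseteq> V\<close>, of k] T by simp
        finally show ?thesis .
      qed simp
    next
      case False
      then have ne: "B \<noteq> {}" and nt: "\<And>T. card T = t \<Longrightarrow> finite T \<Longrightarrow> \<exists>G\<in>B. \<not> T \<subseteq> G" by blast+
      \<comment> \<open>If \<open>k = t\<close>, any two members coincide, so the single member is
        itself a common \<open>t\<close>-set.\<close>
      have "k \<noteq> t"
      proof
        assume "k = t"
        obtain G where G: "G \<in> B" using ne by blast
        then have finG: "finite G" "card G = t" using B \<open>k = t\<close> by (auto simp: nsets_def)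
        have "G \<subseteq> H" if "H \<in> B" for H
        proof -
          have "G \<inter> H = G" using card_seteq[of G "G \<inter> H"] int[OF G that] finG by simp
          then show ?thesis by blast
        qed
        then show False using nt finG by blast
      qed
      then have "t < k" using assms by simp
      have "card B \<le> k ^ (t + 1) * card V ^ (k - (t + 1))"
        using nontrivial_intersecting_family_supersets_le[OF V(1) B int nt ne, of "{}" "t + 1"] by simp
      also have "\<dots> \<le> (card V - t) choose (k - t)"
        using N0[OF \<open>t < k\<close> V(2)] by simp
      finally show ?thesis .
    qed
  qed
qed

section \<open>Sunflowers with a heavy kernel\<close>

text \<open>Each \<open>y \<in> S\<close> shares at most \<open>card V ^ (k - 2)\<close> members
  with \<open>x\<close>, so the members through \<open>x\<close> that meet \<open>S\<close> are too
  few to make up its degree.\<close>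

lemma heavy_vertex_member_avoiding:
  assumes V: "finite V" and Fam: "\<F> \<subseteq> nsets V k"
    and heavy: "card {F \<in> \<F>. x \<in> F} > c * card V ^ (k - 2)"
    and S: "finite S" "x \<notin> S" "card S \<le> c"
  obtains F where "F \<in> \<F>" "x \<in> F" "F \<inter> S = {}"
proof (rule ccontr)
  assume "\<not> thesis"
  then have sub: "{F \<in> \<F>. x \<in> F} \<subseteq> (\<Union>y\<in>S. {F \<in> nsets V k. {x, y} \<subseteq> F})"
    using that Fam by blast
  have "card {F \<in> \<F>. x \<in> F} \<le> card (\<Union>y\<in>S. {F \<in> nsets V k. {x, y} \<subseteq> F})"
    using S V by (intro card_mono[OF _ sub]) (auto simp: finite_imp_finite_nsets)
  also have "\<dots> \<le> (\<Sum>y\<in>S. card {F \<in> nsets V k. {x, y} \<subseteq> F})"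
    using S by (intro card_UN_le)
  also have "\<dots> \<le> (\<Sum>y\<in>S. card V ^ (k - 2))"
  proof (intro sum_mono)
    fix y assume "y \<in> S"
    then have "x \<noteq> y" using S by blast
    then have "card {x, y} = 2" by simp
    then show "card {F \<in> nsets V k. {x, y} \<subseteq> F} \<le> card V ^ (k - 2)"
      using card_nsets_supersets_le_power[OF V, of k "{x, y}"] by simp
  qed
  also have "\<dots> \<le> c * card V ^ (k - 2)" using S by simp
  finally show False using heavy by simp
qed

text \<open>Petals are picked greedily: the next one avoids \<open>W\<close> and, except for
  \<open>x\<close>, all earlier petals, at most \<open>card W + m * k\<close> points in
  total.\<close>

lemma heavy_vertex_sunflower:
  assumes V: "finite V" and Fam: "\<F> \<subseteq> nsets V k"
    and heavy: "card {F \<in> \<F>. x \<in> F} > c * card V ^ (k - 2)"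
    and W: "finite W" "x \<notin> W"
  shows "card W + m * k \<le> c \<Longrightarrow> \<exists>f. \<forall>i\<in>{1..m}. f i \<in> \<F> \<and> x \<in> f i \<and> f i \<inter> W = {} \<and>
    (\<forall>j\<in>{1..m}. i \<noteq> j \<longrightarrow> f i \<inter> f j = {x})"
proof (induction m)
  case 0
  then show ?case by simp
next
  case (Suc m)
  then obtain f where f: "\<forall>i\<in>{1..m}. f i \<in> \<F> \<and> x \<in> f i \<and> f i \<inter> W = {} \<and>
    (\<forall>j\<in>{1..m}. i \<noteq> j \<longrightarrow> f i \<inter> f j = {x})" by auto
  define S where "S = W \<union> ((\<Union>i\<in>{1..m}. f i) - {x})"
  have fin: "finite (f i)" "card (f i) = k" if "i \<in> {1..m}" for i
    using that f Fam by (auto simp: nsets_def)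
  have "card S \<le> card W + card ((\<Union>i\<in>{1..m}. f i) - {x})"
    unfolding S_def by (rule card_Un_le)
  also have "card ((\<Union>i\<in>{1..m}. f i) - {x}) \<le> card (\<Union>i\<in>{1..m}. f i)"
    using fin by (intro card_mono) auto
  also have "\<dots> \<le> (\<Sum>i\<in>{1..m}. card (f i))"
    by (intro card_UN_le) simp
  also have "\<dots> = m * k" using fin by simp
  finally have "card S \<le> c" using Suc.prems by simp
  moreover have "finite S" "x \<notin> S" using W fin by (auto simp: S_def)
  ultimately obtain F where F: "F \<in> \<F>" "x \<in> F" "F \<inter> S = {}"
    using heavy_vertex_member_avoiding[OF V Fam heavy] by metis
  have new: "F \<inter> f i = {x}" "f i \<inter> F = {x}" if "i \<in> {1..m}" for i
    using that F f unfolding S_def by blast+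
  have "F \<inter> W = {}" using F by (auto simp: S_def)
  define g where "g = f(Suc m := F)"
  have gf: "g i = f i" if "i \<in> {1..m}" for i using that by (auto simp: g_def)
  have gF: "g (Suc m) = F" by (simp add: g_def)
  have ivl: "{1..Suc m} = insert (Suc m) {1..m}" by auto
  show ?case
    unfolding ivl using f F(1,2) new \<open>F \<inter> W = {}\<close>
    by (intro exI[of _ g]) (simp add: gf gF)
qed

section \<open>Sums over pairs of indices\<close>

text \<open>Splits off the pairs whose larger index is the last one; applied twice, it isolates the
  two members added to a sunflower.\<close>

lemma sum_pairs_Suc:
  fixes g :: "nat \<times> nat \<Rightarrow> nat"
  shows "sum g {(i, j). 1 \<le> i \<and> i < j \<and> j \<le> Suc m} =
    sum g {(i, j). 1 \<le> i \<and> i < j \<and> j \<le> m} + (\<Sum>i\<in>{1..m}. g (i, Suc m))"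
proof -
  have eq: "{(i, j). 1 \<le> i \<and> i < j \<and> j \<le> Suc m} =
    {(i, j). 1 \<le> i \<and> i < j \<and> j \<le> m} \<union> (\<lambda>i. (i, Suc m)) ` {1..m}"
    by auto
  have fin: "finite {(i, j). 1 \<le> i \<and> i < j \<and> j \<le> m}"
    by (rule finite_subset[of _ "{1..m} \<times> {1..m}"]) auto
  show ?thesis
    unfolding eq using fin
    by (subst sum.union_disjoint) (auto simp: sum.reindex inj_on_def)
qed

lemma sum_pairs_one: "(\<Sum>p\<in>{(i, j). 1 \<le> i \<and> i < j \<and> j \<le> m}. 1 :: nat) = m choose 2"
proof (induction m)
  case 0
  have "{(i, j). 1 \<le> i \<and> i < j \<and> j \<le> (0::nat)} = {}" by auto
  then show ?case by (simp only: sum.empty binomial_0_Suc numeral_2_eq_2)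
next
  case (Suc m)
  then show ?case by (subst sum_pairs_Suc) (simp add: numeral_2_eq_2)
qed

section \<open>Families satisfying the pair-sum condition\<close>

text \<open>The body repeats the hypothesis of the final theorem literally so that it can be folded
  there; \<open>l\<close> distinct members are encoded as an injective indexing by
  \<open>{1..l}\<close>.\<close>

definition pair_sum_condition :: "nat \<Rightarrow> 'a set set \<Rightarrow> bool" where
  "pair_sum_condition l \<F> \<longleftrightarrow>
    (\<forall>F :: nat \<Rightarrow> 'a set. inj_on F {1..l} \<and> F ` {1..l} \<subseteq> \<F> \<longrightarrow>
      (l - 1) choose 2 \<le> (\<Sum>(i, j) \<in> {(i, j). 1 \<le> i \<and> i < j \<and> j \<le> l}. card (F i \<inter> F j)))"

text \<open>Pairwise disjoint members have pair sum 0, whereas \<open>(l - 1) choose 2\<close> is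
  positive for \<open>l \<ge> 3\<close>.\<close>

lemma pair_sum_condition_no_matching:
  assumes "l \<ge> 3" and cond: "pair_sum_condition l \<F>"
    and M: "M \<subseteq> \<F>" "finite M" "pairwise disjnt M"
  shows "card M < l"
proof (rule ccontr)
  assume "\<not> card M < l"
  then obtain M' where M': "M' \<subseteq> M" "card M' = l" by (meson linorder_not_less obtain_subset_with_card_n)
  then have "finite M'" using M finite_subset by blast
  then obtain h where h: "bij_betw h {1..l} M'"
    using finite_same_card_bij[of "{1..l}" M'] M' by auto
  have "(l - 1) choose 2 \<le> (\<Sum>(i, j) \<in> {(i, j). 1 \<le> i \<and> i < j \<and> j \<le> l}. card (h i \<inter> h j))"
    using cond h M M' unfolding pair_sum_condition_def bij_betw_def by blast
  also have "\<dots> = 0"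
  proof (intro sum.neutral, clarify)
    fix i j assume "1 \<le> i" "i < j" "j \<le> l"
    then have "i \<in> {1..l}" "j \<in> {1..l}" "i \<noteq> j" by auto
    then have "h i \<noteq> h j" "h i \<in> M" "h j \<in> M"
      using h M' unfolding bij_betw_def inj_on_def by blast+
    then have "h i \<inter> h j = {}" using M unfolding pairwise_def disjnt_def by blast
    then show "card (h i \<inter> h j) = 0" by simp
  qed
  finally have "(l - 1) choose 2 = 0" by simp
  then show False using \<open>l \<ge> 3\<close> by (simp add: binomial_eq_0_iff)
qed

text \<open>The union of a maximum matching meets every member, as a disjoint one could be added to
  the matching.\<close>

lemma pair_sum_condition_cover:
  assumes "l \<ge> 3" "k \<ge> 1" and cond: "pair_sum_condition l \<F>"
    and V: "finite V" and Fam: "\<F> \<subseteq> nsets V k"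
  obtains U where "finite U" "card U \<le> l * k" "\<And>F. F \<in> \<F> \<Longrightarrow> F \<inter> U \<noteq> {}"
proof -
  have finF: "finite \<F>" using Fam V finite_imp_finite_nsets finite_subset by blast
  let ?P = "\<lambda>M. M \<subseteq> \<F> \<and> pairwise disjnt M"
  have bound: "\<forall>M. ?P M \<longrightarrow> card M < Suc (card \<F>)"
    using finF by (auto intro: card_mono simp: less_Suc_eq_le)
  have "?P {}" by simp
  from ex_has_greatest_nat[of ?P "{}" card, OF this bound] obtain M
    where M: "M \<subseteq> \<F>" "pairwise disjnt M" and max: "\<And>M'. ?P M' \<Longrightarrow> card M' \<le> card M"
    by blast
  have finM: "finite M" using M finF finite_subset by blast
  have "card M \<le> l"
    using pair_sum_condition_no_matching[OF \<open>l \<ge> 3\<close> cond M(1) finM M(2)] by simp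
  have memM: "finite G" "card G = k" if "G \<in> M" for G using that M Fam by (auto simp: nsets_def)
  show thesis
  proof (rule that[of "\<Union>M"])
    show "finite (\<Union>M)" using finM memM by auto
    have "card (\<Union>M) \<le> sum card M" using memM by (intro card_Union_le_sum_card)
    also have "\<dots> = card M * k" using memM by simp
    also have "\<dots> \<le> l * k" using \<open>card M \<le> l\<close> by simp
    finally show "card (\<Union>M) \<le> l * k" .
  next
    fix F assume F: "F \<in> \<F>"
    show "F \<inter> \<Union>M \<noteq> {}"
    proof
      assume disj: "F \<inter> \<Union>M = {}"
      have "F \<noteq> {}" using F Fam \<open>k \<ge> 1\<close> by (auto simp: nsets_def)
      then have "F \<notin> M" using disj by auto
      have "?P (insert F M)"
        using F M disj by (auto simp: pairwise_insert disjnt_def)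
      then have "card (insert F M) \<le> card M" by (rule max)
      then show False using \<open>F \<notin> M\<close> finM by simp
    qed
  qed
qed

lemma heavy_vertex_imp_intersecting:
  assumes "l \<ge> 3" "k \<ge> 2" and cond: "pair_sum_condition l \<F>"
    and V: "finite V" and Fam: "\<F> \<subseteq> nsets V k"
    and heavy: "card {F \<in> \<F>. x \<in> F} > l * k * card V ^ (k - 2)"
    and GH: "G \<in> \<F>" "H \<in> \<F>" "x \<notin> G" "x \<notin> H" "G \<noteq> H"
  shows "l - 2 \<le> card (G \<inter> H)"
proof -
  define m where "m = l - 2"
  have l: "l = Suc (Suc m)" using \<open>l \<ge> 3\<close> by (simp add: m_def)
  have mem: "finite F" "card F = k" if "F \<in> \<F>" for F using that Fam by (auto simp: nsets_def)
  \<comment> \<open>The factor \<open>l * k\<close> in \<open>heavy\<close> is made up of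
    \<open>2 * k\<close> for \<open>G \<union> H\<close> and \<open>(l - 2) * k\<close> for the
    petals.\<close>
  have "card (G \<union> H) \<le> 2 * k" using card_Un_le[of G H] mem GH by simp
  then have "card (G \<union> H) + m * k \<le> l * k" by (simp add: l)
  moreover have "finite (G \<union> H)" "x \<notin> G \<union> H" using GH mem by auto
  ultimately obtain f where f: "\<And>i. i \<in> {1..m} \<Longrightarrow> f i \<in> \<F> \<and> x \<in> f i \<and> f i \<inter> (G \<union> H) = {}"
    and ff: "\<And>i j. i \<in> {1..m} \<Longrightarrow> j \<in> {1..m} \<Longrightarrow> i \<noteq> j \<Longrightarrow> f i \<inter> f j = {x}"
    using heavy_vertex_sunflower[OF V Fam heavy, of "G \<union> H" m] by blast
  define F where "F = f(Suc m := G, Suc (Suc m) := H)"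
  have Ff: "F i = f i" if "i \<in> {1..m}" for i using that by (auto simp: F_def)
  have FG: "F (Suc m) = G" "F (Suc (Suc m)) = H" by (auto simp: F_def)
  have ivl: "{1..l} = insert (Suc (Suc m)) (insert (Suc m) {1..m})" by (auto simp: l)
  \<comment> \<open>Two equal petals would both be \<open>{x}\<close>, against
    \<open>k \<ge> 2\<close>.\<close>
  have "inj_on f {1..m}"
  proof (rule inj_onI, rule ccontr)
    fix i j assume ij: "i \<in> {1..m}" "j \<in> {1..m}" "f i = f j" "i \<noteq> j"
    then have "f i = {x}" using ff[of i j] by simp
    then show False using mem(2)[of "f i"] f[OF ij(1)] \<open>k \<ge> 2\<close> by simp
  qed
  then have "inj_on F {1..m}" using inj_on_cong[of "{1..m}" F f] Ff by blast
  moreover have "G \<notin> F ` {1..m}" "H \<notin> F ` {1..m}"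
    using f Ff GH by blast+
  ultimately have "inj_on F {1..l}"
    unfolding ivl inj_on_insert using FG GH by blast
  moreover have "F ` {1..l} \<subseteq> \<F>" unfolding ivl using f Ff FG GH by (simp add: image_subset_iff)
  ultimately have "(l - 1) choose 2 \<le>
      (\<Sum>(i, j) \<in> {(i, j). 1 \<le> i \<and> i < j \<and> j \<le> l}. card (F i \<inter> F j))"
    using cond unfolding pair_sum_condition_def by blast
  also have "\<dots> = (\<Sum>(i, j) \<in> {(i, j). 1 \<le> i \<and> i < j \<and> j \<le> m}. card (F i \<inter> F j)) +
      (\<Sum>i\<in>{1..m}. card (F i \<inter> G)) + (\<Sum>i\<in>{1..Suc m}. card (F i \<inter> H))"
    unfolding l sum_pairs_Suc by (simp add: FG)
  also have "(\<Sum>(i, j) \<in> {(i, j). 1 \<le> i \<and> i < j \<and> j \<le> m}. card (F i \<inter> F j)) =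
      (\<Sum>p \<in> {(i, j). 1 \<le> i \<and> i < j \<and> j \<le> m}. 1)"
    by (rule sum.cong) (auto simp: Ff ff)
  also have "\<dots> = m choose 2" by (rule sum_pairs_one)
  also have "(\<Sum>i\<in>{1..m}. card (F i \<inter> G)) = 0"
    using f by (intro sum.neutral) (auto simp: Ff Int_Un_distrib)
  also have "(\<Sum>i\<in>{1..Suc m}. card (F i \<inter> H)) = card (G \<inter> H)"
  proof -
    have "(\<Sum>i\<in>{1..m}. card (F i \<inter> H)) = 0"
      using f by (intro sum.neutral) (auto simp: Ff Int_Un_distrib)
    then show ?thesis by (simp add: FG)
  qed
  \<comment> \<open>By Pascal's rule the two binomials differ by \<open>m = l - 2\<close>.\<close>
  finally have "(Suc m) choose 2 \<le> (m choose 2) + card (G \<inter> H)" by (simp add: l)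
  then show ?thesis by (simp add: l numeral_2_eq_2)
qed

section \<open>The bound on the whole family, for \<open>k = 1\<close> and for
  \<open>k \<ge> 2\<close>\<close>

lemma pair_sum_condition_singletons:
  assumes cond: "pair_sum_condition 3 \<F>" and Fam: "\<F> \<subseteq> nsets V 1"
  shows "card \<F> \<le> 2"
proof (rule ccontr)
  assume "\<not> card \<F> \<le> 2"
  then obtain M where M: "M \<subseteq> \<F>" "card M = 3" "finite M"
    by (metis numeral_2_eq_2 numeral_3_eq_3 not_less_eq_eq obtain_subset_with_card_n)
  have "pairwise disjnt M"
    using M Fam by (fastforce simp: pairwise_def disjnt_def nsets_def card_1_singleton_iff)
  then show False
    using pair_sum_condition_no_matching[OF _ cond M(1,3)] M by simp
qed

text \<open>Given a heavy vertex, the members through it account for the first binomial and the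
  others for the second; without one, the first binomial alone suffices.\<close>

lemma pair_sum_condition_card_le:
  fixes l k :: nat
  assumes "l \<ge> 3" "k \<ge> 2" "k \<ge> l - 2"
  obtains n0 where "\<And>n (\<F> :: nat set set). n \<ge> n0 \<Longrightarrow> \<F> \<subseteq> nsets {1..n} k \<Longrightarrow>
    pair_sum_condition l \<F> \<Longrightarrow>
    card \<F> \<le> ((n - 1) choose (k - 1)) + ((n + 1 - l) choose (k + 2 - l))"
proof -
  \<comment> \<open>\<open>c\<close> bounds the cover and is also the factor in the degree
    threshold, so without a heavy vertex the family has at most \<open>c * c * n ^ (k - 2)\<close>
    members.\<close>
  define c where "c = l * k"
  obtain N1 where N1: "\<And>N. N \<ge> N1 \<Longrightarrow> c * c * N ^ (k - 1 - 1) \<le> (N - 1) choose (k - 1)"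
  proof (rule eventually_power_le_binomial)
    show "1 \<le> k - 1" using \<open>k \<ge> 2\<close> by simp
  qed blast
  obtain N2 where N2: "\<And>(V :: nat set) B. finite V \<Longrightarrow> card V \<ge> N2 \<Longrightarrow> B \<subseteq> nsets V k \<Longrightarrow>
    (\<And>G H. G \<in> B \<Longrightarrow> H \<in> B \<Longrightarrow> G \<noteq> H \<Longrightarrow> l - 2 \<le> card (G \<inter> H)) \<Longrightarrow>
    card B \<le> (card V - (l - 2)) choose (k - (l - 2))"
    using Erdos_Ko_Rado_large[OF \<open>k \<ge> l - 2\<close>] by blast
  show thesis
  proof (rule that)
    fix n and \<F> :: "nat set set"
    \<comment> \<open>The extra 1 allows for the ground set losing \<open>x\<close> before
      \<open>N2\<close> is applied.\<close>
    assume n: "n \<ge> N1 + N2 + 1" and Fam: "\<F> \<subseteq> nsets {1..n} k" and cond: "pair_sum_condition l \<F>"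
    have finF: "finite \<F>" using Fam finite_imp_finite_nsets finite_subset by blast
    show "card \<F> \<le> ((n - 1) choose (k - 1)) + ((n + 1 - l) choose (k + 2 - l))"
    proof (cases "\<exists>x. card {F \<in> \<F>. x \<in> F} > c * n ^ (k - 2)")
      case False
      have "k \<ge> 1" using \<open>k \<ge> 2\<close> by simp
      obtain U where U: "finite U" "card U \<le> c" "\<And>F. F \<in> \<F> \<Longrightarrow> F \<inter> U \<noteq> {}"
        using pair_sum_condition_cover[OF \<open>l \<ge> 3\<close> \<open>k \<ge> 1\<close> cond _ Fam] unfolding c_def by auto
      have "card \<F> \<le> card (\<Union>x\<in>U. {F \<in> \<F>. x \<in> F})"
        using U finF by (intro card_mono) auto
      also have "\<dots> \<le> (\<Sum>x\<in>U. card {F \<in> \<F>. x \<in> F})"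
        using U by (intro card_UN_le)
      also have "\<dots> \<le> (\<Sum>x\<in>U. c * n ^ (k - 2))"
        using False by (intro sum_mono) (simp add: not_less)
      also have "\<dots> \<le> c * (c * n ^ (k - 2))" using U by simp
      also have "\<dots> \<le> (n - 1) choose (k - 1)"
        using N1[of n] n by (simp add: mult.assoc numeral_2_eq_2)
      finally show ?thesis by simp
    next
      case True
      then obtain x where x: "card {F \<in> \<F>. x \<in> F} > c * n ^ (k - 2)" by blast
      then have "{F \<in> \<F>. x \<in> F} \<noteq> {}" by force
      then have xn: "x \<in> {1..n}" using Fam unfolding nsets_def by blast
      have "card {F \<in> \<F>. x \<in> F} \<le> card {F \<in> nsets {1..n} k. {x} \<subseteq> F}"
        using Fam by (intro card_mono) (auto simp: finite_imp_finite_nsets)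
      also have "\<dots> \<le> (n - 1) choose (k - 1)"
        using card_nsets_supersets_le[of "{1..n}" "{x}" k] xn by simp
      finally have A: "card {F \<in> \<F>. x \<in> F} \<le> (n - 1) choose (k - 1)" .
      have "card {F \<in> \<F>. x \<notin> F} \<le> (card ({1..n} - {x}) - (l - 2)) choose (k - (l - 2))"
      proof (rule N2)
        show "{F \<in> \<F>. x \<notin> F} \<subseteq> nsets ({1..n} - {x}) k" using Fam by (auto simp: nsets_def)
        show "l - 2 \<le> card (G \<inter> H)"
          if "G \<in> {F \<in> \<F>. x \<notin> F}" "H \<in> {F \<in> \<F>. x \<notin> F}" "G \<noteq> H" for G H
          using heavy_vertex_imp_intersecting[OF \<open>l \<ge> 3\<close> \<open>k \<ge> 2\<close> cond _ Fam, of x G H] that x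
          by (simp add: c_def)
      qed (use n xn in auto)
      \<comment> \<open>Adding before subtracting matters: with truncated subtraction
        \<open>k - l + 2\<close> would be 2 whenever \<open>k < l\<close>.\<close>
      also have "\<dots> = (n + 1 - l) choose (k + 2 - l)"
      proof -
        have "card ({1..n} - {x}) - (l - 2) = n + 1 - l" "k - (l - 2) = k + 2 - l"
          using xn \<open>l \<ge> 3\<close> by auto
        then show ?thesis by simp
      qed
      finally have B: "card {F \<in> \<F>. x \<notin> F} \<le> (n + 1 - l) choose (k + 2 - l)" .
      have "card \<F> = card ({F \<in> \<F>. x \<in> F} \<union> {F \<in> \<F>. x \<notin> F})"
        by (rule arg_cong[of _ _ card]) auto
      also have "\<dots> \<le> card {F \<in> \<F>. x \<in> F} + card {F \<in> \<F>. x \<notin> F}" by (rule card_Un_le)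
      finally show ?thesis using A B by linarith
    qed
  qed
qed

theorem theorem5:
  fixes l k :: nat
  assumes "l \<ge> 3" and "k \<ge> l - 2"
  shows "\<exists>n0::nat. \<forall>n\<ge>n0. \<forall>\<F> :: nat set set.
           \<F> \<subseteq> nsets {1..n} k \<longrightarrow>
           (\<forall>F :: nat \<Rightarrow> nat set. inj_on F {1..l} \<and> F ` {1..l} \<subseteq> \<F> \<longrightarrow>
              (l - 1) choose 2 \<le> (\<Sum>(i, j) \<in> {(i, j). 1 \<le> i \<and> i < j \<and> j \<le> l}. card (F i \<inter> F j))) \<longrightarrow>
           card \<F> \<le> ((n - 1) choose (k - 1)) + ((n + 1 - l) choose (k + 2 - l))"
  unfolding pair_sum_condition_def[symmetric]
\<comment> \<open>Since \<open>l - 2 \<ge> 1\<close>, this is the only value of \<open>k\<close>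
  below 2, the range of the heavy vertex argument.\<close>
proof (cases "k = 1")
  case True
  then have "l = 3" using assms by simp
  show "\<exists>n0::nat. \<forall>n\<ge>n0. \<forall>\<F> :: nat set set. \<F> \<subseteq> nsets {1..n} k \<longrightarrow> pair_sum_condition l \<F> \<longrightarrow>
      card \<F> \<le> ((n - 1) choose (k - 1)) + ((n + 1 - l) choose (k + 2 - l))"
  proof (intro exI allI impI)
    fix n and \<F> :: "nat set set"
    assume "\<F> \<subseteq> nsets {1..n} k" "pair_sum_condition l \<F>"
    then have "card \<F> \<le> 2" using pair_sum_condition_singletons True \<open>l = 3\<close> by blast
    \<comment> \<open>Both lower indices are 0, so the right side is 2 for every
      \<open>n\<close>.\<close>
    then show "card \<F> \<le> ((n - 1) choose (k - 1)) + ((n + 1 - l) choose (k + 2 - l))"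
      by (simp add: True \<open>l = 3\<close>)
  qed
next
  case False
  then have "k \<ge> 2" using assms by simp
  show "\<exists>n0::nat. \<forall>n\<ge>n0. \<forall>\<F> :: nat set set. \<F> \<subseteq> nsets {1..n} k \<longrightarrow> pair_sum_condition l \<F> \<longrightarrow>
      card \<F> \<le> ((n - 1) choose (k - 1)) + ((n + 1 - l) choose (k + 2 - l))"
    by (rule pair_sum_condition_card_le[OF assms(1) \<open>k \<ge> 2\<close> assms(2)]) blast
qed

end
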